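(* Let $n\geq 1$ and $m\geq 1$ be integers, where $m$ is even and $m\neq 4$, and let $K_{n^m}$ be the complete multipartite graph with $m$ parts, each of size $n$. Then $q(K_{n^m})=2$.
   Context: For a simple graph $G$ on vertices $1,\ldots,N$, let $\mathcal{S}(G)$ be the set of all $N\times N$ real symmetric matrices $A$ such that for all $i\neq j$, $A_{ij}\neq 0$ if and only if $i$ and $j$ are adjacent in $G$ (the diagonal entries of $A$ are arbitrary). The parameter $q(G)$ is the minimum number of distinct eigenvalues of a matrix in $\mathcal{S}(G)$. *)

theory Defs
  imports
    "Graph_Theory.Pair_Digraph"
    "Jordan_Normal_Form.Spectral_Radius"
begin

text \<open>
  A simple graph on \<open>N\<close> labelled vertices is a \<open>pair_graph\<close> (finite, loopless, symmetric) with
  vertex set \<open>{..<N}\<close>: vertices are numbered from 0 to match the matrix indices, and an edge is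
  represented by its two opposite arcs.
\<close>

definition sym_matrices :: "nat pair_pre_digraph \<Rightarrow> real mat set" where
  "sym_matrices G = (let N = card (pverts G) in
     {A \<in> carrier_mat N N. transpose_mat A = A \<and>
        (\<forall>i<N. \<forall>j<N. i \<noteq> j \<longrightarrow> (A $$ (i, j) \<noteq> 0 \<longleftrightarrow> (i, j) \<in> parcs G))})"

text \<open>
  The infimum is over a set of natural numbers, nonempty for every simple graph
  (\<open>sym_matrices_nonempty\<close> below), hence a minimum. Taking the spectrum over the reals loses no
  eigenvalue, since the matrices are real symmetric.
\<close>

definition q_param :: "nat pair_pre_digraph \<Rightarrow> nat" where
  "q_param G = (INF A \<in> sym_matrices G. card (spectrum A))"

lemma sym_matrices_nonempty:
  assumes "pair_graph G"
  shows "sym_matrices G \<noteq> {}"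
proof -
  interpret pair_graph G by fact
  have sym: "(i, j) \<in> parcs G \<longleftrightarrow> (j, i) \<in> parcs G" for i j
    using pair_sym_arcs by (auto simp: symmetric_def dest: symD)
  let ?N = "card (pverts G)"
  have "mat ?N ?N (\<lambda>(i, j). if (i, j) \<in> parcs G then 1 else 0) \<in> sym_matrices G"
    by (auto simp: sym_matrices_def Let_def sym)
  then show ?thesis by blast
qed

text \<open>
  The graph \<open>K\<close> with \<open>m\<close> parts of size \<open>n\<close>: the parts are the blocks of consecutive integers
  \<open>{p * n ..< (p + 1) * n}\<close>, \<open>p < m\<close>, so the part of a vertex \<open>i\<close> is \<open>i div n\<close>.
\<close>

definition complete_multipartite :: "nat \<Rightarrow> nat \<Rightarrow> nat pair_pre_digraph" where
  "complete_multipartite n m =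
     \<lparr> pverts = {..<n * m},
       parcs = {(i, j). i < n * m \<and> j < n * m \<and> i div n \<noteq> j div n} \<rparr>"

lemma pair_graph_complete_multipartite: "pair_graph (complete_multipartite n m)"
proof -
  have "finite (parcs (complete_multipartite n m))"
    by (rule finite_subset[of _ "{..<n * m} \<times> {..<n * m}"])
      (auto simp: complete_multipartite_def)
  then show ?thesis
    by unfold_locales
      (auto simp: complete_multipartite_def symmetric_def intro!: symI)
qed

lemma complete_multipartite_part:
  assumes "0 < n" "p < m"
  shows "{i \<in> pverts (complete_multipartite n m). i div n = p} = {p * n..<(p + 1) * n}"
proof -
  have le: "(p + 1) * n \<le> n * m"
    using mult_le_mono1[of "p + 1" m n] assms(2) by (simp add: mult.commute)
  have div: "i div n = p \<longleftrightarrow> p * n \<le> i \<and> i < (p + 1) * n" for i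
  proof -
    have "k = p \<longleftrightarrow> p \<le> k \<and> k < p + 1" for k
      by auto
    from this[of "i div n"] show ?thesis
      by (simp only: less_eq_div_iff_mult_less_eq[OF assms(1)] div_less_iff_less_mult[OF assms(1)])
  qed
  have "pverts (complete_multipartite n m) = {..<n * m}"
    by (simp add: complete_multipartite_def)
  then show ?thesis
    unfolding div set_eq_iff mem_Collect_eq atLeastLessThan_iff lessThan_iff
    using le by (metis less_le_trans)
qed

end

(* If S is an orthogonal symmetric m x m matrix that vanishes exactly on the diagonal, and U is
   an orthogonal symmetric n x n matrix without zero entries, then the Kronecker product of S and U
   has the pattern of the graph and squares to the identity, so its eigenvalues lie in {1, -1}.
   Conversely a real symmetric matrix with at most one eigenvalue is scalar, which is impossible
   as soon as the graph has an edge. *)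

theory Submission
  imports Defs
begin

section \<open>Spectra of real symmetric matrices\<close>

lemma real_symmetric_complex_eigenvalue_is_real:
  fixes A :: "real mat"
  assumes A: "A \<in> carrier_mat n n" and sym: "transpose_mat A = A"
    and ev: "eigenvalue (map_mat complex_of_real A) \<mu>"
  shows "\<mu> \<in> \<real>"
proof -
  obtain v where v: "v \<in> carrier_vec n" "v \<noteq> 0\<^sub>v n"
    and eq: "map_mat complex_of_real A *\<^sub>v v = \<mu> \<cdot>\<^sub>v v"
    using ev A unfolding eigenvalue_def eigenvector_def by auto
  have As: "A $$ (i, j) = A $$ (j, i)" if "i < n" "j < n" for i j
    using sym A that by (metis carrier_matD index_transpose_mat(1))
  have row: "(\<Sum>j<n. of_real (A $$ (i, j)) * v $ j) = \<mu> * v $ i" if "i < n" for i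
  proof -
    have "(map_mat complex_of_real A *\<^sub>v v) $ i = \<mu> * v $ i"
      using eq v(1) that by auto
    then show ?thesis
      using A v(1) that by (simp add: scalar_prod_def atLeast0LessThan)
  qed
  \<comment> \<open>The Hermitian form of the eigenvector, evaluated in two ways: the eigenvalue
    equation gives \<mu> times the squared norm, and symmetry of \<open>A\<close> makes
    \<open>s\<close> its own conjugate.\<close>
  define s where "s = (\<Sum>i<n. \<Sum>j<n. cnj (v $ i) * of_real (A $$ (i, j)) * v $ j)"
  have s_eq: "s = \<mu> * of_real (\<Sum>i<n. (cmod (v $ i))\<^sup>2)"
  proof -
    have "s = (\<Sum>i<n. cnj (v $ i) * (\<mu> * v $ i))"
      unfolding s_def
      by (intro sum.cong refl) (simp add: row[symmetric] sum_distrib_left mult.assoc)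
    then show ?thesis
      by (simp add: sum_distrib_left complex_norm_square mult_ac del: of_real_power)
  qed
  have "cnj s = (\<Sum>i<n. \<Sum>j<n. cnj (v $ j) * of_real (A $$ (i, j)) * v $ i)"
    by (simp add: s_def mult_ac)
  also have "\<dots> = s"
    unfolding s_def by (subst sum.swap) (intro sum.cong refl, simp add: As)
  finally have "s \<in> \<real>"
    by (simp add: Reals_cnj_iff)
  moreover have "(\<Sum>i<n. (cmod (v $ i))\<^sup>2) \<noteq> 0"
    using v by (subst sum_nonneg_eq_0_iff) auto
  ultimately show ?thesis
    unfolding s_eq by (metis Reals_divide Reals_of_real nonzero_mult_div_cancel_right of_real_eq_0_iff)
qed

text \<open>Cyclicity of the trace, by exchanging the two summations; it allows a trace to be
  computed from a similar matrix.\<close>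

lemma sum_diag_mult_commute:
  fixes P Q :: "'a :: comm_semiring_0 mat"
  assumes "P \<in> carrier_mat n n" "Q \<in> carrier_mat n n"
  shows "(\<Sum>i<n. (P * Q) $$ (i, i)) = (\<Sum>i<n. (Q * P) $$ (i, i))"
proof -
  have "(\<Sum>i<n. (P * Q) $$ (i, i)) = (\<Sum>i<n. \<Sum>j<n. P $$ (i, j) * Q $$ (j, i))"
    using assms by (simp add: scalar_prod_def atLeast0LessThan)
  also have "\<dots> = (\<Sum>i<n. \<Sum>j<n. Q $$ (i, j) * P $$ (j, i))"
    by (subst sum.swap) (simp add: mult.commute)
  also have "\<dots> = (\<Sum>i<n. (Q * P) $$ (i, i))"
    using assms by (simp add: scalar_prod_def atLeast0LessThan)
  finally show ?thesis .
qed

text \<open>By Schur triangularization the trace of \<open>A\<^sup>2\<close>, which is the sum of the squares of the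
  entries of \<open>A\<close>, vanishes.\<close>

lemma real_symmetric_no_nonzero_eigenvalue:
  fixes A :: "real mat"
  assumes A: "A \<in> carrier_mat n n" and sym: "transpose_mat A = A"
    and ev: "\<And>k. eigenvalue A k \<Longrightarrow> k = 0"
  shows "A = 0\<^sub>m n n"
proof -
  let ?C = "map_mat complex_of_real A"
  have C: "?C \<in> carrier_mat n n" using A by simp
  \<comment> \<open>A complex eigenvalue is real, hence a root of the characteristic polynomial of
    \<open>A\<close> itself, and there \<open>ev\<close> applies.\<close>
  have cev: "\<mu> = 0" if \<mu>: "eigenvalue ?C \<mu>" for \<mu>
  proof -
    obtain r where r: "\<mu> = of_real r"
      using real_symmetric_complex_eigenvalue_is_real[OF A sym \<mu>] by (auto elim: Reals_cases)
    have "poly (map_poly complex_of_real (char_poly A)) (of_real r) = 0"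
      using \<mu> unfolding eigenvalue_root_char_poly[OF C] of_real_hom.char_poly_hom[OF A] r .
    then have "poly (char_poly A) r = 0" by simp
    then show ?thesis
      using ev r eigenvalue_root_char_poly[OF A] by auto
  qed
  obtain es where es: "char_poly ?C = (\<Prod>e\<leftarrow>es. [:- e, 1:])"
    using char_poly_factorized[OF C] by blast
  obtain T P Q where "schur_decomposition ?C es = (T, P, Q)"
    by (cases "schur_decomposition ?C es") auto
  from schur_decomposition[OF C es this]
  have wit: "similar_mat_wit ?C T P Q" and ut: "upper_triangular T" and diag: "diag_mat T = es"
    by auto
  note w = similar_mat_witD2[OF C wit]
  have "e = 0" if "e \<in> set es" for e
    using that by (intro cev) (auto simp: eigenvalue_root_char_poly[OF C] es poly_prod_list
        prod_list_zero_iff image_iff)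
  then have diag0: "T $$ (i, i) = 0" if "i < n" for i
    using that w(5) unfolding diag[symmetric] diag_mat_def by auto
  \<comment> \<open>Off the diagonal, one of the two entries lies below it; on the diagonal both are
    eigenvalues, hence 0.\<close>
  have T0: "T $$ (i, j) * T $$ (j, i) = 0" if "i < n" "j < n" for i j
    using that ut w(5) diag0[of i] upper_triangularD[of T]
    by (cases i j rule: linorder_cases) auto
  \<comment> \<open>In this grouping cyclicity of the trace moves \<open>P\<close> next to its
    inverse \<open>Q\<close>.\<close>
  have "?C * ?C = P * (T * T * Q)"
  proof -
    have "?C * ?C = P * T * (Q * P) * (T * Q)"
      using w(3-7) by (simp add: assoc_mult_mat[of _ n n _ n _ n] mult_carrier_mat[of _ n n _ n])
    then show ?thesis
      using w by (simp add: assoc_mult_mat[of _ n n _ n _ n] mult_carrier_mat[of _ n n _ n])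
  qed
  then have "(\<Sum>i<n. (?C * ?C) $$ (i, i)) = (\<Sum>i<n. (T * T * Q * P) $$ (i, i))"
    using w by (simp only:) (intro sum_diag_mult_commute mult_carrier_mat)
  also have "T * T * Q * P = T * T"
    using w by (simp add: assoc_mult_mat[of _ n n _ n _ n] mult_carrier_mat[of _ n n _ n])
  also have "(\<Sum>i<n. (T * T) $$ (i, i)) = 0"
    using w(5) by (auto simp: scalar_prod_def T0 intro!: sum.neutral)
  also have "(\<Sum>i<n. (?C * ?C) $$ (i, i)) = of_real (\<Sum>i<n. \<Sum>j<n. (A $$ (i, j))\<^sup>2)"
  proof -
    have "A $$ (i, j) = A $$ (j, i)" if "i < n" "j < n" for i j
      using sym A that by (metis carrier_matD index_transpose_mat(1))
    then show ?thesis
      using A by (simp add: scalar_prod_def atLeast0LessThan power2_eq_square)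
  qed
  finally have "(\<Sum>i<n. \<Sum>j<n. (A $$ (i, j))\<^sup>2) = 0"
    by (simp only: of_real_eq_0_iff)
  then have "\<forall>i<n. \<forall>j<n. A $$ (i, j) = 0"
    by (simp add: sum_nonneg_eq_0_iff sum_nonneg)
  then show ?thesis
    using A by auto
qed

text \<open>Shifting by \<open>k\<close> moves the only possible eigenvalue to 0 and reduces the
  claim to the previous lemma. Inclusion instead of equality also covers an empty spectrum.\<close>

lemma real_symmetric_one_eigenvalue_scalar:
  fixes A :: "real mat"
  assumes A: "A \<in> carrier_mat n n" and sym: "transpose_mat A = A"
    and spec: "spectrum A \<subseteq> {k}"
  shows "A = k \<cdot>\<^sub>m 1\<^sub>m n"
proof -
  let ?B = "A - k \<cdot>\<^sub>m 1\<^sub>m n"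
  have "?B = 0\<^sub>m n n"
  proof (rule real_symmetric_no_nonzero_eigenvalue)
    show "?B \<in> carrier_mat n n" by (intro minus_carrier_mat) simp
    have As: "A $$ (i, j) = A $$ (j, i)" if "i < n" "j < n" for i j
      using sym A that by (metis carrier_matD index_transpose_mat(1))
    show "transpose_mat ?B = ?B"
      using A by (auto simp: As)
  next
    fix l assume "eigenvalue ?B l"
    then obtain v where v: "v \<in> carrier_vec n" "v \<noteq> 0\<^sub>v n" and eq: "?B *\<^sub>v v = l \<cdot>\<^sub>v v"
      using A unfolding eigenvalue_def eigenvector_def by auto
    have "(k \<cdot>\<^sub>m 1\<^sub>m n) *\<^sub>v v = k \<cdot>\<^sub>v v"
      using v by (intro eq_vecI) auto
    then have "?B *\<^sub>v v = A *\<^sub>v v - k \<cdot>\<^sub>v v"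
      using A v by (simp add: minus_mult_distrib_mat_vec[of _ n n])
    then have "(A *\<^sub>v v) $ i = (l + k) * v $ i" if "i < n" for i
      using arg_cong[OF eq, of "\<lambda>w. w $ i"] A v that by (auto simp: algebra_simps)
    then have "A *\<^sub>v v = (l + k) \<cdot>\<^sub>v v"
      using A v by auto
    then have "l + k \<in> spectrum A"
      using A v unfolding spectrum_def eigenvalue_def eigenvector_def by auto
    then show "l = 0" using spec by auto
  qed
  then have "?B $$ (i, j) = 0" if "i < n" "j < n" for i j
    using that by simp
  then show ?thesis
    using A by auto
qed

lemma spectrum_involution:
  fixes A :: "'a :: field mat"
  assumes A: "A \<in> carrier_mat n n" and sq: "A * A = 1\<^sub>m n"
  shows "spectrum A \<subseteq> {1, - 1}"
proof
  fix k assume "k \<in> spectrum A"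
  then obtain v where v: "v \<in> carrier_vec n" "v \<noteq> 0\<^sub>v n" and eq: "A *\<^sub>v v = k \<cdot>\<^sub>v v"
    using A unfolding spectrum_def eigenvalue_def eigenvector_def by auto
  have "v = (A * A) *\<^sub>v v" using v by (simp add: sq)
  also have "\<dots> = k \<cdot>\<^sub>v (k \<cdot>\<^sub>v v)"
    using A v by (simp add: assoc_mult_mat_vec[of _ n n _ n] eq mult_mat_vec[of _ n n])
  finally have "v $ i = (k * k) * v $ i" if "i < n" for i
    using that v by (metis carrier_vecD index_smult_vec mult.assoc)
  moreover obtain i where "i < n" "v $ i \<noteq> 0"
    using v by (metis carrier_vecD eq_vecI index_zero_vec)
  ultimately have "k * k = 1" by (metis mult_cancel_right1)
  then show "k \<in> {1, - 1}" by (simp add: square_eq_1_iff)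
qed

section \<open>Index sums and the two factors of the Kronecker product\<close>

lemma sum_div_mod:
  fixes f :: "nat \<Rightarrow> nat \<Rightarrow> 'a :: comm_monoid_add"
  shows "(\<Sum>j<n * m. f (j div n) (j mod n)) = (\<Sum>p<m. \<Sum>r<n. f p r)"
proof -
  have *: "(\<Sum>j = p * n..<p * n + n. f (j div n) (j mod n)) = (\<Sum>r<n. f p r)" for p
    using sum.shift_bounds_nat_ivl[of "\<lambda>j. f (j div n) (j mod n)" 0 "p * n" n]
    by (simp add: add.commute atLeast0LessThan)
  have "(\<Sum>j<n * m. f (j div n) (j mod n)) = (\<Sum>p<m. \<Sum>j = p * n..<p * n + n. f (j div n) (j mod n))"
    by (simp add: sum.nat_group mult.commute)
  then show ?thesis by (simp only: *)
qed

lemma nowhere_zero_symmetric_orthogonal_exists: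
  assumes "n \<ge> 1"
  obtains U :: "nat \<Rightarrow> nat \<Rightarrow> real" where "\<And>r s. U r s = U s r"
    "\<And>r s. r < n \<Longrightarrow> s < n \<Longrightarrow> U r s \<noteq> 0"
    "\<And>r s. r < n \<Longrightarrow> s < n \<Longrightarrow> (\<Sum>t<n. U r t * U t s) = of_bool (r = s)"
proof
  \<comment> \<open>a Householder reflection along \<open>(n + 1, 1, \<dots>, 1)\<close>\<close>
  define v :: "nat \<Rightarrow> real" where "v r = (if r = 0 then real n + 1 else 1)" for r
  define N where "N = (\<Sum>t<n. (v t)\<^sup>2)"
  define U :: "nat \<Rightarrow> nat \<Rightarrow> real" where "U r s = of_bool (r = s) - 2 / N * v r * v s" for r s
  have N: "N = (real n + 1)\<^sup>2 + (real n - 1)"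
  proof -
    obtain k where k: "n = Suc k" using assms by (cases n) auto
    show ?thesis unfolding N_def k sum.lessThan_Suc_shift by (simp add: v_def k)
  qed
  have N_pos: "N > 0" using assms unfolding N by (intro add_pos_nonneg) auto
  show "U r s = U s r" for r s by (simp add: U_def mult_ac eq_commute)
  show "U r s \<noteq> 0" if "r < n" "s < n" for r s
  proof (cases "r = s")
    case False
    then show ?thesis using N_pos by (simp add: U_def v_def)
  next
    case True
    \<comment> \<open>A diagonal entry vanishes exactly in case of equality here. The coordinate
      \<open>n + 1\<close> prevents it: its square exceeds the remaining \<open>n - 1\<close> in
      \<open>N\<close>, and it makes \<open>N\<close> larger than 2. The all-ones vector would fail
      for \<open>n = 2\<close>.\<close>
    have "2 * (v r)\<^sup>2 \<noteq> N"
    proof (cases "r = 0")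
      case True
      have "real n - 1 < (real n + 1)\<^sup>2" using assms by (simp add: power2_eq_square algebra_simps add_nonneg_pos)
      then show ?thesis by (simp add: v_def N True)
    next
      case False
      have "(real n + 1)\<^sup>2 > 2" using assms power_mono[of 2 "real n + 1" 2] by simp
      then show ?thesis using False assms by (simp add: v_def N)
    qed
    then show ?thesis using True N_pos by (auto simp: U_def field_simps power2_eq_square)
  qed
  show "(\<Sum>t<n. U r t * U t s) = of_bool (r = s)" if rs: "r < n" "s < n" for r s
  proof -
    \<comment> \<open>\<open>x\<close> is the entry of the rank-one part and \<open>y * N\<close>
      that of its square; since \<open>N\<close> is the squared norm of \<open>v\<close>, the latter
      cancels the two cross terms.\<close>
    define x where "x = 2 / N * v r * v s"
    define y where "y = 4 / N\<^sup>2 * v r * v s"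
    have "U r t * U t s = of_bool (t = r) * of_bool (r = s) - of_bool (t = r) * x
       - of_bool (t = s) * x + y * (v t)\<^sup>2" for t
      by (auto simp: U_def x_def y_def algebra_simps power2_eq_square)
    moreover have "(\<Sum>t<n. y * (v t)\<^sup>2) = y * N"
      by (simp add: N_def sum_distrib_left)
    ultimately have "(\<Sum>t<n. U r t * U t s) = of_bool (r = s) - 2 * x + y * N"
      using rs by (simp add: sum.distrib sum_subtractf flip: sum_distrib_right)
    also have "y * N = 2 * x" using N_pos by (simp add: x_def y_def power2_eq_square)
    finally show ?thesis by simp
  qed
qed

text \<open>For \<open>I\<close> and \<open>J\<close> of size \<open>k \<ge> 3\<close>, the matrix is
  \<open>[[a(J - I), c(I - J/k)], [c(I - J/k), -a(J - I)]]\<close> with \<open>a = 1/(k - 1)\<close> and \<open>a\<^sup>2 + c\<^sup>2 = 1\<close>.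
  For \<open>k = 2\<close> this breaks down since \<open>c = 0\<close>.\<close>

lemma hollow_symmetric_orthogonal_exists:
  assumes "even m" "m \<noteq> 4"
  obtains S :: "nat \<Rightarrow> nat \<Rightarrow> real" where "\<And>p q. S p q = S q p"
    "\<And>p. p < m \<Longrightarrow> S p p = 0"
    "\<And>p q. p < m \<Longrightarrow> q < m \<Longrightarrow> p \<noteq> q \<Longrightarrow> S p q \<noteq> 0"
    "\<And>p q. p < m \<Longrightarrow> q < m \<Longrightarrow> (\<Sum>t<m. S p t * S t q) = of_bool (p = q)"
proof (cases "m \<le> 2")
  case True
  then have "m = 0 \<or> m = 2" using assms(1) by presburger
  \<comment> \<open>For \<open>m = 2\<close> this is the matrix exchanging two coordinates.\<close>
  then show ?thesis
    by (intro that[of "\<lambda>p q. of_bool (p \<noteq> q)"])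
      (auto simp: numeral_2_eq_2 less_Suc_eq)
next
  case False
  obtain k where m: "m = k + k" using assms(1) by (metis evenE mult_2)
  have k: "k \<ge> 3" using False assms(2) m by presburger
  define a :: real where "a = 1 / (real k - 1)"
  define c where "c = sqrt (1 - a\<^sup>2)"
  \<comment> \<open>The entries of \<alpha>J + \<beta>I. As JJ = kJ, such matrices commute and are
    closed under products, so block products reduce to arithmetic on coefficients.\<close>
  define d where "d \<alpha> \<beta> p q = \<alpha> + \<beta> * of_bool (p = q)" for \<alpha> \<beta> :: real and p q :: nat
  define S where "S p q = (if p < k then if q < k then d a (- a) p q else d (- c / k) c p (q - k)
     else if q < k then d (- c / k) c (p - k) q else d (- a) a (p - k) (q - k))" for p q
  have a: "0 < a" "a < 1" using k by (auto simp: a_def)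
  then have c2: "c\<^sup>2 = 1 - a\<^sup>2" and c: "c > 0" by (auto simp: c_def power_le_one power_less_one_iff)
  have dd: "(\<Sum>t<k. d \<alpha> \<beta> p t * d \<alpha>' \<beta>' t q) =
      d (real k * \<alpha> * \<alpha>' + \<alpha> * \<beta>' + \<beta> * \<alpha>') (\<beta> * \<beta>') p q" if "p < k" "q < k" for p q \<alpha> \<beta> \<alpha>' \<beta>'
  proof -
    have "d \<alpha> \<beta> p t * d \<alpha>' \<beta>' t q = \<alpha> * \<alpha>' + of_bool (t = q) * (\<alpha> * \<beta>') + of_bool (t = p) * (\<beta> * \<alpha>')
        + of_bool (t = p) * (\<beta> * \<beta>' * of_bool (p = q))" for t
      by (auto simp: d_def algebra_simps)
    then show ?thesis using that
      by (simp add: sum.distrib d_def flip: sum_distrib_right)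
  qed
  have d_add: "d \<alpha> \<beta> p q + d \<alpha>' \<beta>' p q = d (\<alpha> + \<alpha>') (\<beta> + \<beta>') p q" for \<alpha> \<beta> \<alpha>' \<beta>' p q
    by (simp add: d_def algebra_simps)
  have sum_split: "(\<Sum>t<k + l. f t) = (\<Sum>t<k. f t) + (\<Sum>t<l. f (k + t))" for l and f :: "nat \<Rightarrow> real"
    by (induction l) (simp_all add: add.assoc)
  \<comment> \<open>The coefficients of J in the squares of the two blocks, up to sign; they must
    cancel in the diagonal blocks of the square of \<open>S\<close>.\<close>
  have key: "a\<^sup>2 * (real k - 2) = c\<^sup>2 / k"
    using k unfolding c2 a_def by (simp add: divide_simps) (simp add: power2_eq_square algebra_simps)
  show ?thesis
  proof (rule that[of S])
    show "S p q = S q p" for p q by (simp add: S_def d_def eq_commute)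
    show "S p p = 0" if "p < m" for p by (simp add: S_def d_def)
    show "S p q \<noteq> 0" if "p < m" "q < m" "p \<noteq> q" for p q
      \<comment> \<open>The cross blocks have entries \<open>- c / k\<close> and
        \<open>c - c / k\<close>, nonzero because \<open>c > 0\<close> and
        \<open>k > 1\<close>.\<close>
      using that a c k m by (auto simp: S_def d_def field_simps)
    show "(\<Sum>t<m. S p t * S t q) = of_bool (p = q)" if pq: "p < m" "q < m" for p q
    proof -
      have split: "(\<Sum>t<m. S p t * S t q) = (\<Sum>t<k. S p t * S t q) + (\<Sum>t<k. S p (k + t) * S (k + t) q)"
        unfolding m by (rule sum_split)
      define P where "P = (if p < k then p else p - k)"
      define Q where "Q = (if q < k then q else q - k)"
      have PQ: "P < k" "Q < k" using pq by (auto simp: P_def Q_def m)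
      have diag: "(\<Sum>t<k. d a (- a) P t * d a (- a) t Q) + (\<Sum>t<k. d (- c / k) c P t * d (- c / k) c t Q)
          = of_bool (P = Q)"
      proof -
        have "real k * a * a + a * (- a) + - a * a + (real k * (- c / k) * (- c / k) + - c / k * c + c * (- c / k))
            = a\<^sup>2 * (real k - 2) - c\<^sup>2 / k"
          using k by (simp add: field_simps power2_eq_square)
        moreover have "- a * (- a) + c * c = 1" using c2 by (simp add: power2_eq_square)
        ultimately show ?thesis
          using key by (simp only: dd[OF PQ] d_add) (simp add: d_def)
      qed
      \<comment> \<open>The blocks commute, so the opposite sign of the lower right block
        annihilates the off-diagonal blocks of the square.\<close>
      have off: "(\<Sum>t<k. d a (- a) P t * d (- c / k) c t Q) = (\<Sum>t<k. d (- c / k) c P t * d a (- a) t Q)"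
        by (simp only: dd[OF PQ]) (simp add: mult_ac)
      have neg: "d (- a) a x y = - d a (- a) x y" for x y by (simp add: d_def)
      show ?thesis
        using diag off pq unfolding split unfolding S_def P_def Q_def
        by (cases "p < k"; cases "q < k") (auto simp: neg sum_negf not_less eq_diff_iff)
    qed
  qed
qed

section \<open>Lower and upper bound for the parameter\<close>

theorem theorem5p10:
  fixes n m :: nat
  assumes "n \<ge> 1" and "m \<ge> 1" and "even m" and "m \<noteq> 4"
  shows "q_param (complete_multipartite n m) = 2"
proof -
  let ?G = "complete_multipartite n m"
  let ?N = "n * m"
  have m: "m \<ge> 2" using assms(2,3) by presburger
  have card: "card (pverts ?G) = ?N" by (simp add: complete_multipartite_def)
  have lower: "2 \<le> card (spectrum A)" if A: "A \<in> sym_matrices ?G" for A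
  proof (rule ccontr)
    assume "\<not> 2 \<le> card (spectrum A)"
    moreover have AN: "A \<in> carrier_mat ?N ?N" and sym: "transpose_mat A = A"
      using A by (auto simp: sym_matrices_def card Let_def)
    \<comment> \<open>Cardinality 0 means an empty spectrum only because the spectrum is
      finite.\<close>
    ultimately obtain k where "spectrum A \<subseteq> {k}"
      using card_finite_spectrum(1)[OF AN]
      by (metis card_1_singletonE card_eq_0_iff empty_subsetI less_2_cases not_le order_refl One_nat_def)
    then have "A = k \<cdot>\<^sub>m 1\<^sub>m ?N"
      by (rule real_symmetric_one_eigenvalue_scalar[OF AN sym])
    \<comment> \<open>The vertices 0 and \<open>n\<close> lie in the first two blocks, which exist
      as \<open>m\<close> is at least 2; a scalar matrix has a zero at this edge.\<close>
    moreover have n: "0 < ?N" "n < ?N" using assms(1) m by auto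
    ultimately have "A $$ (0, n) = 0" using assms(1) by (simp del: nat_0_less_mult_iff)
    moreover have "(0, n) \<in> parcs ?G" using n assms(1) by (simp add: complete_multipartite_def)
    ultimately show False
      using A n assms(1) unfolding sym_matrices_def Let_def card
      by (metis (mono_tags, lifting) mem_Collect_eq not_one_le_zero)
  qed
  obtain S :: "nat \<Rightarrow> nat \<Rightarrow> real" where S: "\<And>p q. S p q = S q p"
    "\<And>p. p < m \<Longrightarrow> S p p = 0"
    "\<And>p q. p < m \<Longrightarrow> q < m \<Longrightarrow> p \<noteq> q \<Longrightarrow> S p q \<noteq> 0"
    "\<And>p q. p < m \<Longrightarrow> q < m \<Longrightarrow> (\<Sum>t<m. S p t * S t q) = of_bool (p = q)"
    by (rule hollow_symmetric_orthogonal_exists[OF assms(3,4)]) (rule that)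
  obtain U :: "nat \<Rightarrow> nat \<Rightarrow> real" where U: "\<And>r s. U r s = U s r"
    "\<And>r s. r < n \<Longrightarrow> s < n \<Longrightarrow> U r s \<noteq> 0"
    "\<And>r s. r < n \<Longrightarrow> s < n \<Longrightarrow> (\<Sum>t<n. U r t * U t s) = of_bool (r = s)"
    by (rule nowhere_zero_symmetric_orthogonal_exists[OF assms(1)]) (rule that)
  define A where "A = mat ?N ?N (\<lambda>(i, j). S (i div n) (j div n) * U (i mod n) (j mod n))"
  have A: "A \<in> carrier_mat ?N ?N" by (simp add: A_def)
  have bounds: "i div n < m" "i mod n < n" if "i < ?N" for i
    using that assms(1) by (auto simp: less_mult_imp_div_less mult.commute)
  have A_in: "A \<in> sym_matrices ?G"
    unfolding sym_matrices_def Let_def card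
  proof (intro CollectI conjI allI impI)
    show "transpose_mat A = A"
      using S(1) U(1) by (auto simp: A_def)
    fix i j assume ij: "i < ?N" "j < ?N" "i \<noteq> j"
    \<comment> \<open>Within a block the factor from \<open>S\<close> is a diagonal entry, hence 0;
      across blocks both factors are nonzero.\<close>
    then show "A $$ (i, j) \<noteq> 0 \<longleftrightarrow> (i, j) \<in> parcs ?G"
      using S(2,3) U(2) bounds by (cases "i div n = j div n") (auto simp: A_def complete_multipartite_def)
  qed (fact A)
  have "A * A = 1\<^sub>m ?N"
  proof
    fix i j assume "i < dim_row (1\<^sub>m ?N)" "j < dim_col (1\<^sub>m ?N)"
    then have ij: "i < ?N" "j < ?N" by auto
    have "(A * A) $$ (i, j) = (\<Sum>t<?N. (S (i div n) (t div n) * S (t div n) (j div n))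
        * (U (i mod n) (t mod n) * U (t mod n) (j mod n)))"
      using ij by (simp add: A_def scalar_prod_def atLeast0LessThan mult_ac)
    \<comment> \<open>Quotient and remainder of the summation index vary independently, so the sum
      splits into an entry of the square of \<open>S\<close> times one of the square of
      \<open>U\<close>.\<close>
    also have "\<dots> = (\<Sum>p<m. S (i div n) p * S p (j div n)) * (\<Sum>r<n. U (i mod n) r * U r (j mod n))"
      by (simp only: sum_div_mod[where f = "\<lambda>p r. (S (i div n) p * S p (j div n))
        * (U (i mod n) r * U r (j mod n))"] sum_product)
    also have "\<dots> = of_bool (i div n = j div n \<and> i mod n = j mod n)"
      using S(4) U(3) bounds ij by simp
    also have "(i div n = j div n \<and> i mod n = j mod n) \<longleftrightarrow> i = j"
      by (metis div_mult_mod_eq)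
    finally show "(A * A) $$ (i, j) = 1\<^sub>m ?N $$ (i, j)" using ij by simp
  qed (use A in auto)
  from card_mono[OF _ spectrum_involution[OF A this]]
  have "card (spectrum A) \<le> 2" by simp
  moreover have "q_param ?G \<le> card (spectrum A)"
    unfolding q_param_def by (intro cINF_lower A_in) simp
  \<comment> \<open>A lower bound passes to the infimum only over a nonempty set;
    \<open>A_in\<close> supplies a member.\<close>
  moreover have "2 \<le> q_param ?G"
    unfolding q_param_def using A_in by (intro cINF_greatest lower) auto
  ultimately show ?thesis by simp
qed

end
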